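(* Let $X$ and $Y$ be real Banach spaces and let $T:Y\to X$ be a bounded linear operator. Then $T$ is weakly compact if and only if for every Lipschitz function $f:X\to\mathbb{R}$ and every $y\in Y$, the function $f\circ T$ is Fréchet differentiable at $y$ whenever $f$ is weak-Hadamard differentiable at $Ty$.
   Context: $T$ is weakly compact if it maps the closed unit ball of $Y$ onto a relatively weakly compact subset of $X$. For a family $\beta$ of bounded nonempty subsets of a Banach space $X$, a function $f:X\to\mathbb{R}$ is $\beta$-differentiable at $x_0\in X$ if there is a bounded linear functional $d_\beta f(x_0):X\to\mathbb{R}$ such that $\lim_{t\to 0}\sup_{u\in A}\left|\frac{f(x_0+tu)-f(x_0)}{t}-d_\beta f(x_0)(u)\right|=0$ for every $A\in\beta$. Fréchet differentiability is $\beta$-differentiability for $\beta$ the family of all nonempty bounded sets; weak-Hadamard differentiability is $\beta$-differentiability for $\beta$ the family of all nonempty relatively weakly compact sets. *)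

theory Defs
  imports "HOL-Analysis.Analysis"
begin

text \<open>The weak topology is the coarsest topology making every bounded linear functional
  continuous; preimages of open sets under the functionals form a subbase.\<close>

definition weak_topology :: "'a::real_normed_vector topology" where
  "weak_topology =
     topology_generated_by {\<phi> -` U | (\<phi> :: 'a \<Rightarrow> real) U. bounded_linear \<phi> \<and> open U}"

lemma topspace_weak_topology [simp]: "topspace weak_topology = UNIV"
proof -
  have "UNIV \<in> {\<phi> -` U | (\<phi> :: 'a \<Rightarrow> real) U. bounded_linear \<phi> \<and> open U}"
    using bounded_linear_zero open_UNIV by blast
  then show ?thesis
    unfolding weak_topology_def topology_generated_by_topspace by blast
qed

definition relatively_weakly_compact :: "'a::real_normed_vector set \<Rightarrow> bool" where
  "relatively_weakly_compact A \<longleftrightarrow> compactin weak_topology (weak_topology closure_of A)"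

definition weakly_compact_operator ::
    "('b::real_normed_vector \<Rightarrow> 'a::real_normed_vector) \<Rightarrow> bool" where
  "weakly_compact_operator T \<longleftrightarrow> bounded_linear T \<and> relatively_weakly_compact (T ` cball 0 1)"

text \<open>The supremum is taken in \<^typ>\<open>ereal\<close>: over an unbounded set of values it is infinite, whereas
  a supremum in \<^typ>\<open>real\<close> would be an unspecified number. The point \<open>t = 0\<close> is excluded by the
  punctured filter \<open>at 0\<close>.\<close>

definition beta_differentiable ::
    "'a::real_normed_vector set set \<Rightarrow> ('a \<Rightarrow> real) \<Rightarrow> 'a \<Rightarrow> bool" where
  "beta_differentiable \<beta> f x0 \<longleftrightarrow>
     (\<exists>D. bounded_linear D \<and>
        (\<forall>A\<in>\<beta>. ((\<lambda>t. SUP u\<in>A. ereal \<bar>(f (x0 + t *\<^sub>R u) - f x0) / t - D u\<bar>) \<longlongrightarrow> 0) (at 0)))"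

definition frechet_differentiable :: "('a::real_normed_vector \<Rightarrow> real) \<Rightarrow> 'a \<Rightarrow> bool" where
  "frechet_differentiable = beta_differentiable {A. A \<noteq> {} \<and> bounded A}"

definition weak_hadamard_differentiable :: "('a::real_normed_vector \<Rightarrow> real) \<Rightarrow> 'a \<Rightarrow> bool" where
  "weak_hadamard_differentiable = beta_differentiable {A. A \<noteq> {} \<and> relatively_weakly_compact A}"

lemma SUP_abs_tendsto_0_iff:
  fixes g :: "real \<Rightarrow> 'a \<Rightarrow> real"
  assumes "A \<noteq> {}"
  shows "((\<lambda>t. SUP u\<in>A. ereal \<bar>g t u\<bar>) \<longlongrightarrow> 0) F \<longleftrightarrow>
    (\<forall>e>0. eventually (\<lambda>t. \<forall>u\<in>A. \<bar>g t u\<bar> \<le> e) F)"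
proof
  assume L: "((\<lambda>t. SUP u\<in>A. ereal \<bar>g t u\<bar>) \<longlongrightarrow> 0) F"
  show "\<forall>e>0. eventually (\<lambda>t. \<forall>u\<in>A. \<bar>g t u\<bar> \<le> e) F"
  proof (intro allI impI)
    fix e :: real assume "e > 0"
    then have "eventually (\<lambda>t. (SUP u\<in>A. ereal \<bar>g t u\<bar>) < ereal e) F"
      using order_tendstoD(2)[OF L, of "ereal e"] by simp
    then show "eventually (\<lambda>t. \<forall>u\<in>A. \<bar>g t u\<bar> \<le> e) F"
    proof (rule eventually_mono)
      fix t assume *: "(SUP u\<in>A. ereal \<bar>g t u\<bar>) < ereal e"
      show "\<forall>u\<in>A. \<bar>g t u\<bar> \<le> e"
      proof
        fix u assume "u \<in> A"
        then have "ereal \<bar>g t u\<bar> \<le> (SUP u\<in>A. ereal \<bar>g t u\<bar>)"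
          by (rule SUP_upper)
        with * have "ereal \<bar>g t u\<bar> < ereal e" by (rule le_less_trans[rotated])
        then show "\<bar>g t u\<bar> \<le> e" by simp
      qed
    qed
  qed
next
  assume R: "\<forall>e>0. eventually (\<lambda>t. \<forall>u\<in>A. \<bar>g t u\<bar> \<le> e) F"
  obtain a where a: "a \<in> A" using assms by blast
  have nonneg: "0 \<le> (SUP u\<in>A. ereal \<bar>g t u\<bar>)" for t
    by (rule SUP_upper2[OF a]) simp
  show "((\<lambda>t. SUP u\<in>A. ereal \<bar>g t u\<bar>) \<longlongrightarrow> 0) F"
  proof (rule order_tendstoI)
    fix b :: ereal assume "b < 0"
    then show "eventually (\<lambda>t. b < (SUP u\<in>A. ereal \<bar>g t u\<bar>)) F"
      using nonneg by (intro always_eventually allI) (rule less_le_trans)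
  next
    fix b :: ereal assume "0 < b"
    then obtain e where e: "0 < ereal e" "ereal e < b" using ereal_dense2 by blast
    then have "eventually (\<lambda>t. \<forall>u\<in>A. \<bar>g t u\<bar> \<le> e) F" using R by simp
    then show "eventually (\<lambda>t. (SUP u\<in>A. ereal \<bar>g t u\<bar>) < b) F"
    proof (rule eventually_mono)
      fix t assume "\<forall>u\<in>A. \<bar>g t u\<bar> \<le> e"
      then have "(SUP u\<in>A. ereal \<bar>g t u\<bar>) \<le> ereal e" by (intro SUP_least) simp
      then show "(SUP u\<in>A. ereal \<bar>g t u\<bar>) < b" using e(2) by (rule le_less_trans)
    qed
  qed
qed

lemma frechet_differentiable_iff_differentiable:
  "frechet_differentiable f x \<longleftrightarrow> f differentiable (at x)"
proof
  assume "frechet_differentiable f x"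
  then obtain D where D: "bounded_linear D" and
    L: "\<And>A. A \<noteq> {} \<Longrightarrow> bounded A \<Longrightarrow>
      ((\<lambda>t. SUP u\<in>A. ereal \<bar>(f (x + t *\<^sub>R u) - f x) / t - D u\<bar>) \<longlongrightarrow> 0) (at 0)"
    unfolding frechet_differentiable_def beta_differentiable_def by auto
  interpret D: bounded_linear D by (rule D)
  have "(f has_derivative D) (at x)"
    unfolding has_derivative_at_alt
  proof (intro conjI allI impI D)
    fix e :: real assume e: "e > 0"
    have "eventually (\<lambda>t. \<forall>u\<in>cball 0 1. \<bar>(f (x + t *\<^sub>R u) - f x) / t - D u\<bar> \<le> e) (at 0)"
    proof -
      have ne: "cball 0 1 \<noteq> ({} :: 'a set)" by simp
      show ?thesis
        using L[OF ne bounded_cball] e unfolding SUP_abs_tendsto_0_iff[OF ne] by blast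
    qed
    then obtain d where d: "d > 0"
      and *: "\<And>t u. t \<noteq> 0 \<Longrightarrow> \<bar>t\<bar> < d \<Longrightarrow> norm u \<le> 1 \<Longrightarrow>
        \<bar>(f (x + t *\<^sub>R u) - f x) / t - D u\<bar> \<le> e"
      unfolding eventually_at by (auto simp: dist_real_def)
    have "norm (f y - f x - D (y - x)) \<le> e * norm (y - x)" if "norm (y - x) < d" for y
    proof (cases "y = x")
      case True
      then show ?thesis by (simp add: D.zero)
    next
      case False
      define t where "t = norm (y - x)"
      define u where "u = (y - x) /\<^sub>R t"
      have t: "t > 0" "t < d" using False that by (auto simp: t_def)
      have u: "norm u \<le> 1" "t *\<^sub>R u = y - x" using t by (auto simp: u_def t_def)
      have "\<bar>(f y - f x) / t - D u\<bar> \<le> e"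
        using *[of t u] t u by simp
      moreover have "f y - f x - D (y - x) = t * ((f y - f x) / t - D u)"
        using t by (simp add: u(2)[symmetric] D.scaleR field_simps)
      ultimately show ?thesis using t by (simp add: abs_mult t_def[symmetric] mult.commute)
    qed
    with d show "\<exists>d>0. \<forall>y. norm (y - x) < d \<longrightarrow> norm (f y - f x - D (y - x)) \<le> e * norm (y - x)"
      by blast
  qed
  then show "f differentiable (at x)" by (auto simp: differentiable_def)
next
  assume "f differentiable (at x)"
  then obtain D where D: "bounded_linear D" and
    L: "\<And>e. e > 0 \<Longrightarrow> \<exists>d>0. \<forall>y. norm (y - x) < d \<longrightarrow>
      norm (f y - f x - D (y - x)) \<le> e * norm (y - x)"
    unfolding differentiable_def has_derivative_at_alt by blast
  interpret D: bounded_linear D by (rule D)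
  have "((\<lambda>t. SUP u\<in>A. ereal \<bar>(f (x + t *\<^sub>R u) - f x) / t - D u\<bar>) \<longlongrightarrow> 0) (at 0)"
    if A: "A \<noteq> {}" "bounded A" for A
    unfolding SUP_abs_tendsto_0_iff[OF A(1)]
  proof (intro allI impI)
    fix e :: real assume e: "e > 0"
    obtain B where B: "B > 0" "\<And>u. u \<in> A \<Longrightarrow> norm u \<le> B"
      using A(2) unfolding bounded_pos by blast
    obtain d where d: "d > 0" and *: "\<And>y. norm (y - x) < d \<Longrightarrow>
        norm (f y - f x - D (y - x)) \<le> e / B * norm (y - x)"
      using L[of "e / B"] e B(1) by auto
    have "\<bar>(f (x + t *\<^sub>R u) - f x) / t - D u\<bar> \<le> e"
      if t: "t \<noteq> 0" "\<bar>t\<bar> < d / B" and u: "u \<in> A" for t u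
    proof -
      have "\<bar>t\<bar> * norm u \<le> \<bar>t\<bar> * B" using B(2)[OF u] by (simp add: mult_left_mono)
      also have "\<dots> < d" using t(2) B(1) by (simp add: field_simps)
      finally have "\<bar>f (x + t *\<^sub>R u) - f x - t * D u\<bar> \<le> e / B * (\<bar>t\<bar> * norm u)"
        using *[of "x + t *\<^sub>R u"] by (simp add: D.scaleR)
      also have "\<dots> \<le> e / B * (\<bar>t\<bar> * B)"
        using B(2)[OF u] e B(1) by (intro mult_left_mono) auto
      also have "\<dots> = e * \<bar>t\<bar>" using B(1) by simp
      finally have "\<bar>f (x + t *\<^sub>R u) - f x - t * D u\<bar> / \<bar>t\<bar> \<le> e"
        using t(1) by (simp add: field_simps)
      moreover have "(f (x + t *\<^sub>R u) - f x) / t - D u = (f (x + t *\<^sub>R u) - f x - t * D u) / t"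
        using t(1) by (simp add: field_simps)
      ultimately show ?thesis by (simp add: abs_divide)
    qed
    then show "eventually (\<lambda>t. \<forall>u\<in>A. \<bar>(f (x + t *\<^sub>R u) - f x) / t - D u\<bar> \<le> e) (at 0)"
      unfolding eventually_at using d B(1)
      by (intro exI[of _ "d / B"]) (auto simp: dist_real_def)
  qed
  with D show "frechet_differentiable f x"
    unfolding frechet_differentiable_def beta_differentiable_def by blast
qed

end

theory Submission
  imports Defs
begin

text \<open>If \<open>T\<close> maps the unit ball to a relatively weakly compact set, weak-Hadamard differentiability of
  \<open>f\<close> at \<open>T y\<close> is uniform over that set, which is Frechet differentiability of \<open>f \<circ> T\<close> at \<open>y\<close>.

  Conversely, let \<open>K\<close>, the image of the unit ball, fail to be relatively weakly compact. Some \<open>F\<close> in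
  the pointwise closure of \<open>K\<close> in the functions on the dual is then at distance more than some
  \<open>\<theta> > 0\<close> from every point of the space. Choosing points \<open>x n\<close> of \<open>K\<close> that approximate \<open>F\<close> on larger
  and larger finite sets of functionals, which separate \<open>F\<close> by \<open>\<theta>\<close> from larger and larger compact
  parts of the span of the \<open>x n\<close>, one gets a sequence such that for a small \<open>\<epsilon>\<close> no sequence within
  \<open>\<epsilon>\<close> of a subsequence of \<open>x\<close> has a weak cluster point. Bumps of slope 1 and height \<open>\<epsilon> / (n + 1)\<close>
  centred at \<open>x n / (n + 1)\<close> have as supremum a Lipschitz function \<open>f\<close> for which \<open>f \<circ> T\<close> is not Frechet
  differentiable at 0. On a relatively weakly compact set the difference quotients of \<open>f\<close> at 0 do
  tend to 0 uniformly, as otherwise bounded multiples of its points would stay within \<open>\<epsilon>\<close> of points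
  \<open>x n\<close>.\<close>

subsection \<open>The Hahn-Banach theorem\<close>

definition sublinear :: "('a::real_vector \<Rightarrow> real) \<Rightarrow> bool" where
  "sublinear p \<longleftrightarrow> (\<forall>x y. p (x + y) \<le> p x + p y) \<and> (\<forall>c>0. \<forall>x. p (c *\<^sub>R x) = c * p x)"

text \<open>The reverse inequality comes from applying the given one with factor
  \<open>inverse c\<close>, so a function defined as an infimum need only be estimated from
  above.\<close>

lemma sublinearI:
  assumes "\<And>x y. p (x + y) \<le> p x + p y" and "\<And>c x. c > 0 \<Longrightarrow> p (c *\<^sub>R x) \<le> c * p x"
  shows "sublinear p"
  unfolding sublinear_def
proof (intro conjI allI impI antisym)
  fix c :: real and x assume c: "c > 0"
  have "p (inverse c *\<^sub>R c *\<^sub>R x) \<le> inverse c * p (c *\<^sub>R x)"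
    using c assms(2)[of "inverse c" "c *\<^sub>R x"] by simp
  then have "p x \<le> inverse c * p (c *\<^sub>R x)"
    using c by simp
  then show "c * p x \<le> p (c *\<^sub>R x)"
    using c by (simp add: field_simps)
qed (use assms in auto)

context
  fixes p :: "'a::real_vector \<Rightarrow> real"
  assumes p: "sublinear p"
begin

lemma sublinear_add: "p (x + y) \<le> p x + p y"
  using p by (simp add: sublinear_def)

lemma sublinear_scale: "c > 0 \<Longrightarrow> p (c *\<^sub>R x) = c * p x"
  using p by (simp add: sublinear_def)

lemma sublinear_zero: "p 0 = 0"
  using sublinear_scale[of 2 0] by simp

lemma sublinear_scale_nonneg: "c \<ge> 0 \<Longrightarrow> p (c *\<^sub>R x) = c * p x"
  using sublinear_scale[of c x] sublinear_zero by (cases "c = 0") auto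

lemma sublinear_ge_uminus: "- p (- x) \<le> p x"
  using sublinear_add[of x "- x"] sublinear_zero by simp

text \<open>Take the infimum of \<open>p (x + t *\<^sub>R w) - t * p w\<close> over
  \<open>t \<ge> 0\<close>, which subadditivity bounds below by \<open>- p (- x)\<close>. The
  parameter 0 gives \<open>q \<le> p\<close>, the parameter 1 gives the bound at
  \<open>- w\<close>.\<close>

lemma sublinear_tilt:
  obtains q where "sublinear q" "q \<le> p" "q (- w) \<le> - p w"
proof
  define q where "q x = (INF t\<in>{0..}. p (x + t *\<^sub>R w) - t * p w)" for x
  have bd: "bdd_below ((\<lambda>t. p (x + t *\<^sub>R w) - t * p w) ` {0..})" for x
  proof (rule bdd_belowI2)
    fix t :: real assume "t \<in> {0..}"
    then show "- p (- x) \<le> p (x + t *\<^sub>R w) - t * p w"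
      using sublinear_add[of "x + t *\<^sub>R w" "- x"] sublinear_scale_nonneg[of t w] by simp
  qed
  have le: "q x \<le> p (x + t *\<^sub>R w) - t * p w" if "t \<ge> 0" for x t
    unfolding q_def by (rule cINF_lower[OF bd]) (use that in simp)
  have ge: "m \<le> q x" if "\<And>t. t \<ge> 0 \<Longrightarrow> m \<le> p (x + t *\<^sub>R w) - t * p w" for x m
    unfolding q_def by (rule cINF_greatest) (use that in auto)
  show "q \<le> p"
    using le[of 0] by (simp add: le_fun_def)
  show "q (- w) \<le> - p w"
    using le[of 1 "- w"] sublinear_zero by simp
  show "sublinear q"
  proof (rule sublinearI)
    fix x y
    have "q (x + y) - (p (x + s *\<^sub>R w) - s * p w) \<le> q y" if s: "s \<ge> 0" for s
    proof (rule ge)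
      fix t :: real assume t: "t \<ge> 0"
      have "q (x + y) \<le> p ((x + s *\<^sub>R w) + (y + t *\<^sub>R w)) - (s + t) * p w"
        using le[of "s + t" "x + y"] s t by (simp add: algebra_simps)
      then show "q (x + y) - (p (x + s *\<^sub>R w) - s * p w) \<le> p (y + t *\<^sub>R w) - t * p w"
        using sublinear_add[of "x + s *\<^sub>R w" "y + t *\<^sub>R w"] by (simp add: algebra_simps)
    qed
    then have "q (x + y) - q y \<le> q x"
      by (intro ge) (simp add: algebra_simps)
    then show "q (x + y) \<le> q x + q y" by simp
  next
    fix c :: real and x assume c: "c > 0"
    have "q (c *\<^sub>R x) / c \<le> q x"
    proof (rule ge)
      fix t :: real assume "t \<ge> 0"
      then show "q (c *\<^sub>R x) / c \<le> p (x + t *\<^sub>R w) - t * p w"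
        using le[of "c * t" "c *\<^sub>R x"] c sublinear_scale[OF c, of "x + t *\<^sub>R w"]
        by (simp add: field_simps scaleR_add_right)
    qed
    then show "q (c *\<^sub>R x) \<le> c * q x" using c by (simp add: field_simps)
  qed
qed

end

text \<open>Zorn's lemma for the reversed pointwise order: a nonempty chain is bounded below by its
  pointwise infimum.\<close>

lemma sublinear_minimal_le:
  fixes p :: "'a::real_vector \<Rightarrow> real"
  assumes p: "sublinear p"
  obtains q where "sublinear q" "q \<le> p" "\<And>r. sublinear r \<Longrightarrow> r \<le> q \<Longrightarrow> r = q"
proof -
  define A where "A = {q. sublinear q \<and> q \<le> p}"
  have po: "partial_order_on A (relation_of (\<lambda>q r. r \<le> q) A)"
    unfolding partial_order_on_def preorder_on_def refl_on_def trans_def antisym_def relation_of_def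
    by auto
  have lower: "\<exists>u\<in>A. \<forall>q\<in>C. u \<le> q" if C: "C \<in> Chains (relation_of (\<lambda>q r. r \<le> q) A)" for C
  proof (cases "C = {}")
    case True
    then show ?thesis using p unfolding A_def by auto
  next
    case False
    have CA: "\<And>q. q \<in> C \<Longrightarrow> sublinear q \<and> q \<le> p"
      and total: "\<And>q r. q \<in> C \<Longrightarrow> r \<in> C \<Longrightarrow> q \<le> r \<or> r \<le> q"
      using C unfolding Chains_def relation_of_def A_def by auto
    define u where "u x = (INF q\<in>C. q x)" for x
    have bd: "bdd_below ((\<lambda>q. q x) ` C)" for x
    proof (rule bdd_belowI2)
      fix q assume q: "q \<in> C"
      have "- q (- x) \<le> q x"
        using CA[OF q] sublinear_ge_uminus by blast
      moreover have "q (- x) \<le> p (- x)" using CA[OF q] by (simp add: le_fun_def)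
      ultimately show "- p (- x) \<le> q x" by simp
    qed
    have le: "u x \<le> q x" if "q \<in> C" for x q
      unfolding u_def by (rule cINF_lower[OF bd that])
    have ge: "m \<le> u x" if "\<And>q. q \<in> C \<Longrightarrow> m \<le> q x" for x m
      unfolding u_def by (rule cINF_greatest[OF False that])
    have "sublinear u"
    proof (rule sublinearI)
      fix x y
      have "u (x + y) - q x \<le> u y" if q: "q \<in> C" for q
      proof (rule ge)
        fix r assume r: "r \<in> C"
        \<comment> \<open>Subadditivity of the infimum rests on totality of the chain: the smaller
          of two members lies below both.\<close>
        obtain s where s: "s \<in> C" "s \<le> q" "s \<le> r" using total[OF q r] q r by auto
        have "u (x + y) \<le> s x + s y"
          using le[OF s(1), of "x + y"] CA[OF s(1)] unfolding sublinear_def by (meson order_trans)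
        also have "\<dots> \<le> q x + r y" using s by (intro add_mono) (auto simp: le_fun_def)
        finally show "u (x + y) - q x \<le> r y" by simp
      qed
      then have "u (x + y) - u y \<le> u x"
        by (intro ge) (simp add: algebra_simps)
      then show "u (x + y) \<le> u x + u y" by simp
    next
      fix c :: real and x assume c: "c > 0"
      have "u (c *\<^sub>R x) / c \<le> u x"
      proof (rule ge)
        fix q assume q: "q \<in> C"
        then show "u (c *\<^sub>R x) / c \<le> q x"
          using le[OF q, of "c *\<^sub>R x"] CA[OF q] c unfolding sublinear_def by (simp add: field_simps)
      qed
      then show "u (c *\<^sub>R x) \<le> c * u x" using c by (simp add: field_simps)
    qed
    moreover have "u \<le> p"
      using False le CA by (metis all_not_in_conv le_fun_def order_trans)
    ultimately show ?thesis using le by (auto simp: A_def le_fun_def)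
  qed
  from predicate_Zorn[OF po lower] obtain q
    where "q \<in> A" "\<And>r. r \<in> A \<Longrightarrow> r \<le> q \<Longrightarrow> r = q" by blast
  then show thesis by (intro that[of q]) (auto simp: A_def intro: order_trans)
qed

text \<open>A minimal sublinear function is linear: tilting it in a direction does not change it.\<close>
lemma hahn_banach_sublinear:
  fixes p :: "'a::real_vector \<Rightarrow> real"
  assumes p: "sublinear p"
  obtains q where "linear q" "q \<le> p" "q w = p w"
proof -
  \<comment> \<open>Tilting before minimising stores a bound at \<open>- w\<close>; once the minimal
    \<open>q\<close> is known to be odd, it reads \<open>p w \<le> q w\<close>.\<close>
  obtain p' where p': "sublinear p'" "p' \<le> p" "p' (- w) \<le> - p w"
    using sublinear_tilt[OF p] by blast
  obtain q where q: "sublinear q" "q \<le> p'" and min: "\<And>r. sublinear r \<Longrightarrow> r \<le> q \<Longrightarrow> r = q"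
    using sublinear_minimal_le[OF p'(1)] by blast
  note q_rules = sublinear_add[OF q(1)] sublinear_scale_nonneg[OF q(1)] sublinear_zero[OF q(1)]
  have neg: "q (- v) = - q v" for v
  proof -
    obtain r where "sublinear r" "r \<le> q" "r (- v) \<le> - q v"
      using sublinear_tilt[OF q(1)] by blast
    with min[of r] have "q (- v) \<le> - q v" by blast
    then show ?thesis using sublinear_ge_uminus[OF q(1), of v] by simp
  qed
  have "linear q"
  proof (rule linearI)
    fix x y
    have "q x + q y \<le> q (x + y)"
      using q_rules(1)[of "- x" "- y"] neg[of x] neg[of y] neg[of "x + y"] by simp
    then show "q (x + y) = q x + q y" using q_rules(1)[of x y] by simp
  next
    fix c :: real and x
    show "q (c *\<^sub>R x) = c *\<^sub>R q x"
    proof (cases "c \<ge> 0")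
      case True then show ?thesis by (simp add: q_rules(2))
    next
      case False then show ?thesis
        using q_rules(2)[of "- c" x] neg[of "c *\<^sub>R x"] by simp
    qed
  qed
  moreover have "q \<le> p" using q(2) p'(2) by simp
  moreover have "q w = p w"
  proof (rule antisym)
    show "q w \<le> p w" using \<open>q \<le> p\<close> by (simp add: le_fun_def)
    have "q (- w) \<le> - p w" using q(2) p'(3) by (auto simp: le_fun_def intro: order_trans)
    then show "p w \<le> q w" by (simp add: neg)
  qed
  ultimately show thesis by (rule that)
qed

section \<open>Functionals and the distance to a subspace\<close>

lemma infdist_less_attained:
  assumes "infdist x Z < d" "Z \<noteq> {}"
  shows "\<exists>z\<in>Z. dist x z < d"
proof -
  have "(INF z\<in>Z. dist x z) < d" using assms by (simp add: infdist_notempty)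
  then show ?thesis
    by (subst (asm) cINF_less_iff) (auto simp: assms(2) intro!: bdd_belowI[of _ 0])
qed

text \<open>The distance to a subspace is sublinear, symmetric, zero on the subspace and at most the
  norm. A linear function below it that agrees with it at \<open>w\<close> therefore has all the
  required properties.\<close>

lemma functional_attaining_infdist:
  fixes Z :: "'a::real_normed_vector set"
  assumes Z: "subspace Z"
  obtains \<phi> :: "'a \<Rightarrow>\<^sub>L real"
  where "norm \<phi> \<le> 1" "\<And>z. z \<in> Z \<Longrightarrow> blinfun_apply \<phi> z = 0" "blinfun_apply \<phi> w = infdist w Z"
proof -
  have approx: "\<exists>z\<in>Z. dist x z < infdist x Z + e" if "e > 0" for x e
    using infdist_less_attained[of x Z "infdist x Z + e"] subspace_0[OF Z] that by auto
  have "sublinear (\<lambda>x. infdist x Z)"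
  proof (rule sublinearI)
    fix x y
    show "infdist (x + y) Z \<le> infdist x Z + infdist y Z"
    proof (rule field_le_epsilon)
      fix e :: real assume e: "e > 0"
      obtain a b where a: "a \<in> Z" "dist x a < infdist x Z + e/2"
        and b: "b \<in> Z" "dist y b < infdist y Z + e/2"
        using approx[of "e/2"] e by (meson half_gt_zero)
      have "infdist (x + y) Z \<le> dist (x + y) (a + b)"
        by (intro infdist_le subspace_add[OF Z] a b)
      also have "\<dots> \<le> dist x a + dist y b" by (rule dist_triangle_add)
      finally show "infdist (x + y) Z \<le> infdist x Z + infdist y Z + e" using a b by simp
    qed
  next
    fix c :: real and x :: 'a assume c: "c > 0"
    have "infdist (c *\<^sub>R x) Z / c \<le> infdist x Z"
    proof (rule field_le_epsilon)
      fix e :: real assume e: "e > 0"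
      obtain a where a: "a \<in> Z" "dist x a < infdist x Z + e" using approx[OF e] by blast
      have "infdist (c *\<^sub>R x) Z \<le> dist (c *\<^sub>R x) (c *\<^sub>R a)"
        by (intro infdist_le subspace_scale[OF Z] a)
      also have "\<dots> = c * dist x a" using c by (simp add: dist_norm flip: scaleR_diff_right)
      finally have "infdist (c *\<^sub>R x) Z / c \<le> dist x a" using c by (simp add: field_simps)
      then show "infdist (c *\<^sub>R x) Z / c \<le> infdist x Z + e" using a by simp
    qed
    then show "infdist (c *\<^sub>R x) Z \<le> c * infdist x Z" using c by (simp add: field_simps)
  qed
  then obtain q where q: "linear q" "q \<le> (\<lambda>x. infdist x Z)" "q w = infdist w Z"
    by (rule hahn_banach_sublinear)
  interpret q: linear q by (rule q(1))
  have bound: "\<bar>q x\<bar> \<le> infdist x Z" for x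
  proof -
    have "infdist (- x) Z \<le> infdist x Z"
    proof (rule field_le_epsilon)
      fix e :: real assume e: "e > 0"
      obtain a where a: "a \<in> Z" "dist x a < infdist x Z + e" using approx[OF e] by blast
      have "infdist (- x) Z \<le> dist (- x) (- a)"
        by (intro infdist_le subspace_neg[OF Z] a)
      then show "infdist (- x) Z \<le> infdist x Z + e" using a by (simp add: dist_minus)
    qed
    moreover have "q x \<le> infdist x Z" "q (- x) \<le> infdist (- x) Z"
      using q(2) by (auto simp: le_fun_def)
    ultimately show ?thesis by (simp add: q.neg)
  qed
  have norm_bound: "\<bar>q x\<bar> \<le> norm x" for x
    using bound[of x] infdist_le[OF subspace_0[OF Z], of x] by simp
  have bl: "bounded_linear q"
    by (rule bounded_linear_intro[of _ 1]) (use norm_bound q.add q.scale in auto)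
  show thesis
  proof (rule that[of "Blinfun q"])
    show "norm (Blinfun q) \<le> 1"
      by (rule norm_blinfun_bound) (use norm_bound in \<open>auto simp: bounded_linear_Blinfun_apply bl\<close>)
    show "blinfun_apply (Blinfun q) z = 0" if "z \<in> Z" for z
      using bound[of z] infdist_le[OF that, of z] by (simp add: bounded_linear_Blinfun_apply bl that)
    show "blinfun_apply (Blinfun q) w = infdist w Z"
      by (simp add: bounded_linear_Blinfun_apply bl q(3))
  qed
qed

lemma abs_blinfun_apply_le_norm:
  fixes \<phi> :: "'a::real_normed_vector \<Rightarrow>\<^sub>L real"
  assumes "norm \<phi> \<le> 1"
  shows "\<bar>blinfun_apply \<phi> x\<bar> \<le> norm x"
  using norm_blinfun[of \<phi> x] mult_right_mono[OF assms, of "norm x"] by simp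

lemma norming_functional:
  fixes x :: "'a::real_normed_vector"
  obtains \<phi> :: "'a \<Rightarrow>\<^sub>L real" where "norm \<phi> \<le> 1" "blinfun_apply \<phi> x = norm x"
  using functional_attaining_infdist[of "{0}" x] by auto

subsection \<open>Weak compactness and the pointwise topology on the dual\<close>

text \<open>The canonical embedding into the bidual, with values taken as bare functions on the
  dual, so that the topology of the function type is pointwise convergence.\<close>

definition dual_eval :: "'a::real_normed_vector \<Rightarrow> ('a \<Rightarrow>\<^sub>L real) \<Rightarrow> real" where
  "dual_eval x \<phi> = blinfun_apply \<phi> x"

lemma openin_weak_vimage:
  assumes "bounded_linear (\<phi> :: 'a::real_normed_vector \<Rightarrow> real)" "open U"
  shows "openin weak_topology (\<phi> -` U)"
  unfolding weak_topology_def by (rule topology_generated_by_Basis) (use assms in blast)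

lemma continuous_map_weak:
  assumes "bounded_linear (\<phi> :: 'a::real_normed_vector \<Rightarrow> real)"
  shows "continuous_map weak_topology euclidean \<phi>"
  unfolding continuous_map_def using openin_weak_vimage[OF assms] by (auto simp: vimage_def)

lemma openin_weak_dual_eval_vimage:
  assumes "open V"
  shows "openin weak_topology (dual_eval -` V)"
proof -
  have "continuous_map weak_topology (product_topology (\<lambda>_. euclidean) UNIV) dual_eval"
    unfolding continuous_map_componentwise_UNIV dual_eval_def
    by (intro allI continuous_map_weak blinfun.bounded_linear_right)
  then show ?thesis
    using assms by (auto simp: euclidean_product_topology continuous_map_def vimage_def)
qed

text \<open>With the preceding lemma this makes the weak topology the pullback of pointwise
  convergence along \<open>dual_eval\<close>. A subbasic set is the preimage of a condition on one
  coordinate, and preimages commute with intersections and unions.\<close>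

lemma openin_weak_imp_dual_eval_vimage:
  assumes "openin weak_topology (U :: 'a::real_normed_vector set)"
  shows "\<exists>V. open V \<and> U = dual_eval -` V"
proof -
  have "generate_topology_on {\<phi> -` U | (\<phi> :: 'a \<Rightarrow> real) U. bounded_linear \<phi> \<and> open U} U"
    using assms unfolding weak_topology_def by (rule openin_topology_generated_by)
  then show ?thesis
  proof induction
    case Empty
    show ?case by (intro exI[of _ "{}"] conjI open_empty vimage_empty[symmetric])
  next
    case (Int a b)
    then obtain V W where "open V" "a = dual_eval -` V" "open W" "b = dual_eval -` W" by blast
    then show ?case by (intro exI[of _ "V \<inter> W"]) (simp add: open_Int)
  next
    case (UN K)
    then obtain V where "\<And>k. k \<in> K \<Longrightarrow> open (V k)" and V: "\<And>k. k \<in> K \<Longrightarrow> k = dual_eval -` V k"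
      by metis
    then have "open (\<Union>(V ` K))" by blast
    moreover have "\<Union>K = dual_eval -` \<Union>(V ` K)"
      using V by (simp add: vimage_UN)
    ultimately show ?case by blast
  next
    case (Basis s)
    then obtain \<phi> and W :: "real set"
      where s: "s = \<phi> -` W" "bounded_linear \<phi>" "open W" by blast
    have "open ((\<lambda>f. f (Blinfun \<phi>)) -` W)"
      using s(3) by (intro open_vimage continuous_on_product_coordinates)
    moreover have "s = dual_eval -` ((\<lambda>f. f (Blinfun \<phi>)) -` W)"
      using s by (auto simp: dual_eval_def bounded_linear_Blinfun_apply)
    ultimately show ?case by blast
  qed
qed

text \<open>By Tychonoff the pointwise closure of \<open>K\<close> in the functions on the dual is compact, so
  weak compactness can only fail by a limit that no point of the space represents.\<close>
lemma relatively_weakly_compact_if_closure_evaluations: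
  fixes K :: "'a::real_normed_vector set"
  assumes "bounded K" and rep: "closure (dual_eval ` K) \<subseteq> range dual_eval"
  shows "relatively_weakly_compact K"
proof -
  obtain M where M: "\<And>x. x \<in> K \<Longrightarrow> norm x \<le> M" using assms(1) unfolding bounded_iff by blast
  \<comment> \<open>The product of the intervals to which the bound \<open>M\<close> confines the
    value of each functional on \<open>K\<close>.\<close>
  define P where "P = {f. \<forall>\<phi> :: 'a \<Rightarrow>\<^sub>L real. - (norm \<phi> * M) \<le> f \<phi> \<and> f \<phi> \<le> norm \<phi> * M}"
  have "P = (\<Pi>\<^sub>E \<phi>\<in>(UNIV :: ('a \<Rightarrow>\<^sub>L real) set). {- (norm \<phi> * M) .. norm \<phi> * M})"
    by (auto simp: P_def PiE_def Pi_def extensional_def)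
  moreover have "compactin (product_topology (\<lambda>_. euclidean) UNIV)
      (\<Pi>\<^sub>E \<phi>\<in>(UNIV :: ('a \<Rightarrow>\<^sub>L real) set). {- (norm \<phi> * M) .. norm \<phi> * M})"
    unfolding compactin_PiE by simp
  ultimately have P: "compact P" by (simp add: euclidean_product_topology)
  have closedP: "closed P"
    unfolding P_def
    by (intro closed_Collect_all closed_Collect_conj closed_Collect_le
        continuous_on_product_coordinates continuous_on_const)
  have "dual_eval ` K \<subseteq> P"
  proof (clarsimp simp: P_def dual_eval_def)
    fix x and \<phi> :: "'a \<Rightarrow>\<^sub>L real" assume "x \<in> K"
    then have "norm (blinfun_apply \<phi> x) \<le> norm \<phi> * M"
      using norm_blinfun[of \<phi> x] M[of x] by (meson mult_left_mono norm_ge_zero order_trans)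
    then show "- (norm \<phi> * M) \<le> blinfun_apply \<phi> x \<and> blinfun_apply \<phi> x \<le> norm \<phi> * M"
      by (auto simp: abs_le_iff)
  qed
  then have "closure (dual_eval ` K) \<subseteq> P"
    using closedP by (rule closure_minimal)
  then have C: "compact (closure (dual_eval ` K))"
    using P by (metis closed_closure compact_Int_closed inf.absorb2)
  have "compactin weak_topology (dual_eval -` closure (dual_eval ` K))"
    unfolding compactin_def
  proof (intro conjI allI impI)
    fix \<U> :: "'a set set"
    assume U: "Ball \<U> (openin weak_topology) \<and> dual_eval -` closure (dual_eval ` K) \<subseteq> \<Union>\<U>"
    then obtain V where V: "\<And>u. u \<in> \<U> \<Longrightarrow> open (V u)" "\<And>u. u \<in> \<U> \<Longrightarrow> u = dual_eval -` V u"
      using openin_weak_imp_dual_eval_vimage by metis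
    \<comment> \<open>Here \<open>rep\<close> is decisive: every point of the closure is an
      evaluation, so the sets \<open>V u\<close> cover the whole closure and not only its part
      inside the range.\<close>
    have "closure (dual_eval ` K) \<subseteq> (\<Union>u\<in>\<U>. V u)"
    proof
      fix F assume F: "F \<in> closure (dual_eval ` K)"
      then obtain x where x: "F = dual_eval x" using rep by blast
      then obtain u where "u \<in> \<U>" "x \<in> u" using F U by blast
      then show "F \<in> (\<Union>u\<in>\<U>. V u)" using V(2) x by blast
    qed
    then obtain D where D: "D \<subseteq> \<U>" "finite D" "closure (dual_eval ` K) \<subseteq> (\<Union>u\<in>D. V u)"
      using compactE_image[OF C, of \<U> V] V(1) by blast
    have "dual_eval -` closure (dual_eval ` K) \<subseteq> \<Union>D"
    proof
      fix x assume "x \<in> dual_eval -` closure (dual_eval ` K)"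
      then obtain u where "u \<in> D" "dual_eval x \<in> V u" using D(3) by blast
      then show "x \<in> \<Union>D" using V(2) D(1) by blast
    qed
    then show "\<exists>\<F>. finite \<F> \<and> \<F> \<subseteq> \<U> \<and> dual_eval -` closure (dual_eval ` K) \<subseteq> \<Union>\<F>"
      using D by blast
  qed simp
  moreover have "weak_topology closure_of K \<subseteq> dual_eval -` closure (dual_eval ` K)"
  proof (rule closure_of_minimal)
    show "K \<subseteq> dual_eval -` closure (dual_eval ` K)"
      using closure_subset[of "dual_eval ` K"] by (simp add: image_subset_iff_subset_vimage)
    have "openin weak_topology (dual_eval -` (- closure (dual_eval ` K)))"
      by (intro openin_weak_dual_eval_vimage open_Compl closed_closure)
    then show "closedin weak_topology (dual_eval -` closure (dual_eval ` K))"
      by (simp add: closedin_def vimage_Diff Compl_eq_Diff_UNIV)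
  qed
  ultimately show ?thesis
    unfolding relatively_weakly_compact_def by (rule closed_compactin) (rule closedin_closure_of)
qed

lemma closure_dual_eval_approx:
  assumes F: "F \<in> closure (dual_eval ` K)" and "finite P" "e > 0"
  obtains x where "x \<in> K" "\<And>\<phi>. \<phi> \<in> P \<Longrightarrow> \<bar>blinfun_apply \<phi> x - F \<phi>\<bar> < e"
proof -
  define U where "U = (\<Inter>\<phi>\<in>P. {f. \<bar>f \<phi> - F \<phi>\<bar> < e})"
  have "open U"
    unfolding U_def using \<open>finite P\<close>
    by (intro open_INT ballI open_Collect_less continuous_intros continuous_on_product_coordinates) auto
  moreover have "F \<in> U" using \<open>e > 0\<close> by (simp add: U_def)
  ultimately have "dual_eval ` K \<inter> U \<noteq> {}"
    using F open_Int_closure_eq_empty by (metis Int_commute disjoint_iff)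
  then obtain x where "x \<in> K" "dual_eval x \<in> U" by blast
  then show thesis using that by (simp add: U_def dual_eval_def)
qed

text \<open>Evaluations are homogeneous, and each instance of the equation is a closed condition in
  the pointwise topology.\<close>

lemma closure_dual_eval_scale:
  assumes F: "F \<in> closure (dual_eval ` K)"
  shows "F (c *\<^sub>R \<phi>) = c * F \<phi>"
proof -
  have "closure (dual_eval ` K) \<subseteq> {f. f (c *\<^sub>R \<phi>) = c * f \<phi>}"
    by (intro closure_minimal closed_Collect_eq continuous_intros continuous_on_product_coordinates)
      (auto simp: dual_eval_def blinfun.scaleR_left)
  then show ?thesis using F by blast
qed

text \<open>Completeness enters here: the evaluations are closed among the homogeneous functions on the
  dual, with respect to uniform convergence on the unit ball.\<close>
lemma dual_eval_gap:
  fixes F :: "('a::banach \<Rightarrow>\<^sub>L real) \<Rightarrow> real"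
  assumes hom: "\<And>c \<phi>. F (c *\<^sub>R \<phi>) = c * F \<phi>" and F: "F \<notin> range dual_eval"
  obtains \<theta> where "\<theta> > 0" "\<And>x. \<exists>\<phi>. norm \<phi> \<le> 1 \<and> \<theta> < \<bar>F \<phi> - blinfun_apply \<phi> x\<bar>"
proof (rule ccontr)
  assume "\<not> thesis"
  \<comment> \<open>Without a gap, points of the space approximate \<open>F\<close> uniformly on the
    dual unit ball.\<close>
  then have "\<exists>x. \<forall>\<phi>. norm \<phi> \<le> 1 \<longrightarrow> \<bar>F \<phi> - blinfun_apply \<phi> x\<bar> \<le> inverse (real (Suc n))" for n
    using that[of "inverse (real (Suc n))"] by (meson inverse_positive_iff_positive not_le of_nat_0_less_iff zero_less_Suc)
  then obtain x where x: "\<And>n \<phi>. norm \<phi> \<le> 1 \<Longrightarrow> \<bar>F \<phi> - blinfun_apply \<phi> (x n)\<bar> \<le> inverse (real (Suc n))"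
    by metis
  \<comment> \<open>The norm of the difference is the value of one functional of norm at most 1, at
    which both points are close to \<open>F\<close>.\<close>
  have dist: "norm (x m - x n) \<le> inverse (real (Suc m)) + inverse (real (Suc n))" for m n
  proof -
    obtain \<phi> :: "'a \<Rightarrow>\<^sub>L real" where \<phi>: "norm \<phi> \<le> 1" "blinfun_apply \<phi> (x m - x n) = norm (x m - x n)"
      by (rule norming_functional)
    then show ?thesis
      using x[OF \<phi>(1), of m] x[OF \<phi>(1), of n] by (simp add: blinfun.diff_right)
  qed
  have "Cauchy x"
  proof (rule CauchyI)
    fix e :: real assume "e > 0"
    then obtain N where N: "inverse (real (Suc N)) < e / 2" using reals_Archimedean[of "e/2"] by auto
    have "norm (x m - x n) < e" if "m \<ge> N" "n \<ge> N" for m n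
    proof -
      have "inverse (real (Suc m)) \<le> inverse (real (Suc N))" "inverse (real (Suc n)) \<le> inverse (real (Suc N))"
        using that by (auto intro!: le_imp_inverse_le)
      then show ?thesis using dist[of m n] N by linarith
    qed
    then show "\<exists>N. \<forall>m\<ge>N. \<forall>n\<ge>N. norm (x m - x n) < e" by blast
  qed
  then obtain l where l: "x \<longlonglongrightarrow> l" by (auto simp: Cauchy_convergent_iff convergent_def)
  have ball: "F \<phi> = blinfun_apply \<phi> l" if \<phi>: "norm \<phi> \<le> 1" for \<phi>
  proof -
    have "(\<lambda>n. \<bar>F \<phi> - blinfun_apply \<phi> (x n)\<bar>) \<longlonglongrightarrow> \<bar>F \<phi> - blinfun_apply \<phi> l\<bar>"
      by (intro tendsto_intros l)
    moreover have "(\<lambda>n. \<bar>F \<phi> - blinfun_apply \<phi> (x n)\<bar>) \<longlonglongrightarrow> 0"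
      by (rule tendsto_sandwich[OF _ _ tendsto_const LIMSEQ_inverse_real_of_nat]) (use x[OF \<phi>] in auto)
    ultimately show ?thesis using LIMSEQ_unique by fastforce
  qed
  have "F \<phi> = dual_eval l \<phi>" for \<phi>
  proof (cases "norm \<phi> \<le> 1")
    case True
    then show ?thesis by (simp add: ball dual_eval_def)
  next
    case False
    then have pos: "norm \<phi> > 0" by linarith
    then have "F \<phi> = norm \<phi> * blinfun_apply (inverse (norm \<phi>) *\<^sub>R \<phi>) l"
      using hom[of "norm \<phi>" "inverse (norm \<phi>) *\<^sub>R \<phi>"] ball[of "inverse (norm \<phi>) *\<^sub>R \<phi>"] by simp
    also have "\<dots> = dual_eval l \<phi>" using pos by (simp add: dual_eval_def blinfun.scaleR_left)
    finally show ?thesis .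
  qed
  then show False using F by blast
qed

section \<open>A sequence that stays away from cluster points\<close>

text \<open>Weaker than being a cluster point in the weak topology: only one functional is tested
  at a time.\<close>
definition scalar_cluster_point :: "'a::real_normed_vector \<Rightarrow> (nat \<Rightarrow> 'a) \<Rightarrow> bool" where
  "scalar_cluster_point l u \<longleftrightarrow>
     (\<forall>\<phi> :: 'a \<Rightarrow>\<^sub>L real. \<forall>e>0. \<exists>\<^sub>F k in sequentially. \<bar>blinfun_apply \<phi> (u k) - blinfun_apply \<phi> l\<bar> < e)"

lemma non_weakly_compact_sequence:
  fixes K :: "'a::banach set"
  assumes K: "bounded K" "\<not> relatively_weakly_compact K"
  shows "\<exists>(x :: nat \<Rightarrow> 'a) \<epsilon>. \<epsilon> > 0 \<and> (\<forall>n. x n \<in> K) \<and> (\<forall>n. \<epsilon> < norm (x n)) \<and>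
    (\<forall>s w l. filterlim s at_top sequentially \<longrightarrow> (\<forall>k. norm (w k - x (s k)) \<le> \<epsilon>) \<longrightarrow>
       \<not> scalar_cluster_point l w)"
proof -
  obtain F where F: "F \<in> closure (dual_eval ` K)" "F \<notin> range dual_eval"
    using relatively_weakly_compact_if_closure_evaluations[OF K(1)] K(2) by blast
  obtain \<theta> where \<theta>: "\<theta> > 0"
    "\<And>x. \<exists>\<phi>. norm \<phi> \<le> 1 \<and> \<theta> < \<bar>F \<phi> - blinfun_apply \<phi> x\<bar>"
    using dual_eval_gap[OF closure_dual_eval_scale[OF F(1)] F(2)] by metis
  define \<epsilon> where "\<epsilon> = \<theta> / 8"
  have \<epsilon>: "\<epsilon> > 0" "\<theta> = 8 * \<epsilon>" using \<theta>(1) by (auto simp: \<epsilon>_def)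
  \<comment> \<open>For a fixed functional the strict inequality is an open condition on
    \<open>q\<close>, so finitely many functionals serve a compact set.\<close>
  have separate: "\<exists>P. finite P \<and> (\<forall>\<phi>\<in>P. norm \<phi> \<le> 1) \<and> (\<forall>q\<in>Q. \<exists>\<phi>\<in>P. \<theta> < \<bar>F \<phi> - blinfun_apply \<phi> q\<bar>)"
    if Q: "compact Q" for Q
  proof -
    have op: "open {q. \<theta> < \<bar>F \<phi> - blinfun_apply \<phi> q\<bar>}" for \<phi>
      by (intro open_Collect_less continuous_intros)
    have cover: "Q \<subseteq> (\<Union>\<phi>\<in>{\<phi>. norm \<phi> \<le> 1}. {q. \<theta> < \<bar>F \<phi> - blinfun_apply \<phi> q\<bar>})"
      using \<theta>(2) by blast
    obtain P where "P \<subseteq> {\<phi>. norm \<phi> \<le> 1}" "finite P"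
      "Q \<subseteq> (\<Union>\<phi>\<in>P. {q. \<theta> < \<bar>F \<phi> - blinfun_apply \<phi> q\<bar>})"
      by (rule compactE_image[OF Q op cover])
    then show ?thesis by (intro exI[of _ P]) auto
  qed
  \<comment> \<open>The compact sets produced by \<open>grow\<close> exhaust a subspace containing the sequence.\<close>
  define grow where "grow n Q x = (\<lambda>((a, b, c), (q, r)). a *\<^sub>R q + b *\<^sub>R r + c *\<^sub>R x) `
      (({- real (Suc n)..real (Suc n)} \<times> {- real (Suc n)..real (Suc n)} \<times> {- real (Suc n)..real (Suc n)})
        \<times> (Q \<times> Q))" for n Q and x :: 'a
  have growI: "a *\<^sub>R q + b *\<^sub>R r + c *\<^sub>R x \<in> grow n Q x"
    if "q \<in> Q" "r \<in> Q" "\<bar>a\<bar> \<le> real (Suc n)" "\<bar>b\<bar> \<le> real (Suc n)" "\<bar>c\<bar> \<le> real (Suc n)"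
    for a b c n q r Q x
    unfolding grow_def using that
    by (intro image_eqI[of _ _ "((a, b, c), (q, r))"]) (auto simp: abs_le_iff)
  have compact_grow: "compact (grow n Q x)" if "compact Q" for n Q x
    unfolding grow_def case_prod_unfold
    by (intro compact_continuous_image compact_Times compact_Icc that continuous_intros)
  have grow_mono: "q \<in> grow n Q x" if "q \<in> Q" for n q Q x
    using growI[of q Q q 1 n 0 0 x] that by simp
  \<comment> \<open>A state consists of a compact set, a finite set of functionals of norm at most
    1, and the point chosen last.\<close>
  define good where "good S \<longleftrightarrow> compact (fst S) \<and> 0 \<in> fst S \<and> finite (fst (snd S)) \<and>
    (\<forall>\<phi>\<in>fst (snd S). norm \<phi> \<le> 1) \<and> snd (snd S) \<in> K"
    for S :: "'a set \<times> ('a \<Rightarrow>\<^sub>L real) set \<times> 'a"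
  \<comment> \<open>The order matters: new functionals first separate \<open>F\<close> from the old
    compact set, then a point is chosen to approximate \<open>F\<close> on all functionals so far,
    and only then the compact set grows by that point.\<close>
  define step where "step n S S' \<longleftrightarrow> fst S' = grow n (fst S) (snd (snd S')) \<and>
    fst (snd S) \<subseteq> fst (snd S') \<and>
    (\<forall>q\<in>fst S. \<exists>\<phi>\<in>fst (snd S'). \<theta> < \<bar>F \<phi> - blinfun_apply \<phi> q\<bar>) \<and>
    (\<forall>\<phi>\<in>fst (snd S'). \<bar>blinfun_apply \<phi> (snd (snd S')) - F \<phi>\<bar> < \<epsilon>)"
    for n and S S' :: "'a set \<times> ('a \<Rightarrow>\<^sub>L real) set \<times> 'a"
  have "\<exists>S. \<forall>n. good (S n) \<and> step n (S n) (S (Suc n))"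
  proof (rule dependent_nat_choice)
    obtain x where "x \<in> K" using closure_dual_eval_approx[OF F(1), of "{}" 1] by auto
    then show "\<exists>S. good S" by (intro exI[of _ "({0}, {}, x)"]) (simp add: good_def)
  next
    fix S n assume S: "good S"
    obtain P where P: "finite P" "\<forall>\<phi>\<in>P. norm \<phi> \<le> 1"
      "\<forall>q\<in>fst S. \<exists>\<phi>\<in>P. \<theta> < \<bar>F \<phi> - blinfun_apply \<phi> q\<bar>"
      using separate[of "fst S"] S unfolding good_def by blast
    define P' where "P' = fst (snd S) \<union> P"
    have P': "finite P'" "\<forall>\<phi>\<in>P'. norm \<phi> \<le> 1" using P S by (auto simp: P'_def good_def)
    obtain x where x: "x \<in> K" "\<And>\<phi>. \<phi> \<in> P' \<Longrightarrow> \<bar>blinfun_apply \<phi> x - F \<phi>\<bar> < \<epsilon>"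
      using closure_dual_eval_approx[OF F(1) P'(1) \<epsilon>(1)] by blast
    have "good (grow n (fst S) x, P', x)"
      using S P' x grow_mono compact_grow by (auto simp: good_def)
    moreover have "step n S (grow n (fst S) x, P', x)"
      using P(3) x(2) by (auto simp: step_def P'_def)
    ultimately show "\<exists>S'. good S' \<and> step n S S'" by blast
  qed
  then obtain S where S: "\<And>n. good (S n)" "\<And>n. step n (S n) (S (Suc n))" by blast
  \<comment> \<open>The point \<open>x n\<close> is read off stage \<open>Suc n\<close>, where it is
    chosen against \<open>P (Suc n)\<close> and enters \<open>Q (Suc n)\<close>.\<close>
  define Q P x where "Q n = fst (S n)" and "P n = fst (snd (S n))" and "x n = snd (snd (S (Suc n)))" for n
  have Q0: "0 \<in> Q n" and P1: "\<And>\<phi>. \<phi> \<in> P n \<Longrightarrow> norm \<phi> \<le> 1" and xK: "x n \<in> K" for n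
    using S(1)[of n] S(1)[of "Suc n"] by (auto simp: good_def Q_def P_def x_def)
  have QSuc: "Q (Suc n) = grow n (Q n) (x n)" and PSuc: "P n \<subseteq> P (Suc n)"
    and sep: "\<And>q. q \<in> Q n \<Longrightarrow> \<exists>\<phi>\<in>P (Suc n). \<theta> < \<bar>F \<phi> - blinfun_apply \<phi> q\<bar>"
    and approx: "\<And>\<phi>. \<phi> \<in> P (Suc n) \<Longrightarrow> \<bar>blinfun_apply \<phi> (x n) - F \<phi>\<bar> < \<epsilon>" for n
    using S(2)[of n] by (auto simp: step_def Q_def P_def x_def)
  have Qmono: "Q m \<subseteq> Q n" if "m \<le> n" for m n
    by (rule lift_Suc_mono_le[OF _ that]) (auto simp: QSuc grow_mono)
  have Pmono: "P m \<subseteq> P n" if "m \<le> n" for m n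
    by (rule lift_Suc_mono_le[OF _ that]) (rule PSuc)
  have approx': "\<bar>blinfun_apply \<phi> (x n) - F \<phi>\<bar> < \<epsilon>" if "\<phi> \<in> P (Suc m)" "m \<le> n" for \<phi> m n
    using approx[of \<phi> n] Pmono[of "Suc m" "Suc n"] that by auto
  define Z where "Z = (\<Union>n. Q n)"
  have Z: "subspace Z"
    unfolding subspace_def
  proof (intro conjI ballI allI)
    show "0 \<in> Z" using Q0 by (auto simp: Z_def)
  next
    fix u v assume "u \<in> Z" "v \<in> Z"
    then obtain i j where "u \<in> Q i" "v \<in> Q j" by (auto simp: Z_def)
    then have "u \<in> Q (max i j)" "v \<in> Q (max i j)" using Qmono[of i "max i j"] Qmono[of j "max i j"] by auto
    then have "u + v \<in> Q (Suc (max i j))"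
      using growI[of u "Q (max i j)" v 1 "max i j" 1 0] by (simp add: QSuc)
    then show "u + v \<in> Z" by (auto simp: Z_def)
  next
    fix c :: real and u assume "u \<in> Z"
    then obtain i where i: "u \<in> Q i" by (auto simp: Z_def)
    \<comment> \<open>The stage must be late enough both to contain \<open>u\<close> and to admit
      \<open>c\<close> as a coefficient.\<close>
    obtain j where j: "\<bar>c\<bar> \<le> real j" using real_arch_simple by blast
    have c: "\<bar>c\<bar> \<le> real (Suc (max i j))" using j by (rule order_trans) simp
    have u: "u \<in> Q (max i j)" using i Qmono[of i "max i j"] by auto
    have "c *\<^sub>R u \<in> Q (Suc (max i j))"
      unfolding QSuc using growI[OF u u c, of 0 0 "x (max i j)"] by simp
    then show "c *\<^sub>R u \<in> Z" by (auto simp: Z_def)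
  qed
  have xZ: "x n \<in> Z" for n
  proof -
    have "x n \<in> Q (Suc n)"
      unfolding QSuc using growI[OF Q0[of n] Q0[of n], where a = 0 and b = 0 and c = 1 and n = n and x = "x n"] by simp
    then show ?thesis by (auto simp: Z_def)
  qed
  show ?thesis
  proof (intro exI[of _ x] exI[of _ \<epsilon>] conjI allI impI \<epsilon>(1) xK)
    fix n
    \<comment> \<open>Separation from the point 0 of the first compact set:
      \<open>\<bar>F \<phi>\<bar>\<close> exceeds \<open>8 * \<epsilon>\<close> and every
      \<open>x n\<close> matches it up to \<open>\<epsilon>\<close>.\<close>
    obtain \<phi> where \<phi>: "\<phi> \<in> P (Suc 0)" "\<theta> < \<bar>F \<phi>\<bar>" using sep[OF Q0[of 0]] by auto
    have "\<bar>blinfun_apply \<phi> (x n)\<bar> \<le> norm (x n)"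
      by (rule abs_blinfun_apply_le_norm[OF P1[OF \<phi>(1)]])
    then show "\<epsilon> < norm (x n)"
      using \<phi>(2) approx'[OF \<phi>(1), of n] \<epsilon> by linarith
  next
    fix s :: "nat \<Rightarrow> nat" and w l
    assume s: "filterlim s at_top sequentially" and w: "\<forall>k. norm (w k - x (s k)) \<le> \<epsilon>"
    show "\<not> scalar_cluster_point l w"
    proof
      assume l: "scalar_cluster_point l w"
      have cluster: "\<exists>k. N \<le> s k \<and> \<bar>blinfun_apply \<phi> (w k) - blinfun_apply \<phi> l\<bar> < \<epsilon>" for N \<phi>
      proof -
        have "\<forall>\<^sub>F k in sequentially. N \<le> s k" using s by (simp add: filterlim_at_top)
        moreover have "\<exists>\<^sub>F k in sequentially. \<bar>blinfun_apply \<phi> (w k) - blinfun_apply \<phi> l\<bar> < \<epsilon>"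
          using l \<epsilon>(1) by (simp add: scalar_cluster_point_def)
        ultimately have "\<exists>\<^sub>F k in sequentially. N \<le> s k \<and> \<bar>blinfun_apply \<phi> (w k) - blinfun_apply \<phi> l\<bar> < \<epsilon>"
          by (rule frequently_eventually_conj[rotated])
        then show ?thesis by (auto dest: frequently_ex)
      qed
      \<comment> \<open>This functional kills every \<open>x n\<close>, so it is at most
        \<open>\<epsilon>\<close> in absolute value on \<open>w\<close>; clustering then puts
        \<open>l\<close> within \<open>3 * \<epsilon>\<close> of \<open>Z\<close>.\<close>
      obtain \<phi> where \<phi>: "norm \<phi> \<le> 1" "\<And>z. z \<in> Z \<Longrightarrow> blinfun_apply \<phi> z = 0"
        "blinfun_apply \<phi> l = infdist l Z"
        using functional_attaining_infdist[OF Z, of l] by blast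
      obtain k where k: "\<bar>blinfun_apply \<phi> (w k) - blinfun_apply \<phi> l\<bar> < \<epsilon>" using cluster by blast
      have "\<bar>blinfun_apply \<phi> (w k - x (s k))\<bar> \<le> \<epsilon>" using abs_blinfun_apply_le_norm[OF \<phi>(1)] w[rule_format, of k] by (rule order_trans)
      then have "infdist l Z < 3 * \<epsilon>"
        using k \<phi>(2)[OF xZ] \<epsilon>(1) by (simp add: blinfun.diff_right \<phi>(3))
      then obtain z where z: "z \<in> Z" "dist l z < 3 * \<epsilon>"
        using infdist_less_attained xZ by blast
      \<comment> \<open>Some \<open>\<psi>\<close> separates \<open>F\<close> from \<open>z\<close>
        by \<open>8 * \<epsilon>\<close>. Going from \<open>F\<close> to \<open>x (s i)\<close>, to
        \<open>w i\<close> and to \<open>l\<close> costs at most \<open>\<epsilon>\<close> each, and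
        from \<open>l\<close> to \<open>z\<close> at most \<open>3 * \<epsilon>\<close>:
        \<open>6 * \<epsilon>\<close> in all, a contradiction.\<close>
      obtain N where "z \<in> Q N" using z(1) by (auto simp: Z_def)
      then obtain \<psi> where \<psi>: "\<psi> \<in> P (Suc N)" "\<theta> < \<bar>F \<psi> - blinfun_apply \<psi> z\<bar>" using sep by blast
      note unit\<psi> = abs_blinfun_apply_le_norm[OF P1[OF \<psi>(1)]]
      obtain i where i: "N \<le> s i" "\<bar>blinfun_apply \<psi> (w i) - blinfun_apply \<psi> l\<bar> < \<epsilon>"
        using cluster by blast
      have "\<bar>blinfun_apply \<psi> (w i - x (s i))\<bar> \<le> \<epsilon>" using unit\<psi> w[rule_format, of i] by (rule order_trans)
      moreover have "\<bar>blinfun_apply \<psi> (l - z)\<bar> < 3 * \<epsilon>"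
        using unit\<psi>[of "l - z"] z(2) by (simp add: dist_norm)
      ultimately show False
        using i(2) approx'[OF \<psi>(1) i(1)] \<psi>(2) \<epsilon>(2) by (simp add: blinfun.diff_right)
    qed
  qed
qed

subsection \<open>Differentiability\<close>

text \<open>Otherwise each point of \<open>C\<close> has an open neighbourhood that the sequence
  eventually avoids; finitely many of them cover \<open>C\<close>, and a late term has no place
  left.\<close>

lemma compactin_sequence_cluster_point:
  assumes C: "compactin X C" and u: "\<And>k. u k \<in> C"
  obtains l where "l \<in> C" "\<And>U. openin X U \<Longrightarrow> l \<in> U \<Longrightarrow> \<exists>\<^sub>F k in sequentially. u k \<in> U"
proof (rule ccontr)
  assume "\<not> thesis"
  then have "\<forall>l\<in>C. \<exists>U. openin X U \<and> l \<in> U \<and> \<not> (\<exists>\<^sub>F k in sequentially. u k \<in> U)"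
    using that by blast
  then obtain U where U: "\<And>l. l \<in> C \<Longrightarrow> openin X (U l)" "\<And>l. l \<in> C \<Longrightarrow> l \<in> U l"
    "\<And>l. l \<in> C \<Longrightarrow> \<forall>\<^sub>F k in sequentially. u k \<notin> U l"
    unfolding not_frequently by metis
  have "Ball (U ` C) (openin X)" "C \<subseteq> \<Union>(U ` C)" using U(1,2) by auto
  then obtain \<F> where F: "finite \<F>" "\<F> \<subseteq> U ` C" "C \<subseteq> \<Union>\<F>"
    using C unfolding compactin_def by meson
  have "\<forall>\<^sub>F k in sequentially. \<forall>V\<in>\<F>. u k \<notin> V"
    using F(1,2) U(3) by (intro eventually_ball_finite) auto
  then obtain k where "\<forall>V\<in>\<F>. u k \<notin> V" using eventually_happens by force
  then show False using u[of k] F(3) by blast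
qed

lemma relatively_weakly_compact_scalar_cluster_point:
  fixes u :: "nat \<Rightarrow> 'a::real_normed_vector"
  assumes W: "relatively_weakly_compact W" "\<And>k. u k \<in> W" and r: "r \<longlonglongrightarrow> a"
  obtains l where "scalar_cluster_point (a *\<^sub>R l) (\<lambda>k. r k *\<^sub>R u k)"
proof -
  have "u k \<in> weak_topology closure_of W" for k
    using W(2) closure_of_subset[of W weak_topology] by auto
  then obtain l where l: "\<And>U. openin weak_topology U \<Longrightarrow> l \<in> U \<Longrightarrow> \<exists>\<^sub>F k in sequentially. u k \<in> U"
    using compactin_sequence_cluster_point W(1) unfolding relatively_weakly_compact_def by metis
  have "scalar_cluster_point (a *\<^sub>R l) (\<lambda>k. r k *\<^sub>R u k)"
    unfolding scalar_cluster_point_def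
  proof (intro allI impI)
    fix \<phi> :: "'a \<Rightarrow>\<^sub>L real" and e :: real assume e: "e > 0"
    \<comment> \<open>With both errors at most \<open>d \<le> 1\<close>, the functional is at most
      \<open>\<bar>blinfun_apply \<phi> l\<bar> + 1\<close> in absolute value on \<open>u k\<close>,
      and the total deviation is at most \<open>d * M\<close>.\<close>
    define M where "M = \<bar>blinfun_apply \<phi> l\<bar> + 1 + \<bar>a\<bar>"
    have M: "M > 0" by (simp add: M_def)
    define d where "d = min 1 (e / (2 * M))"
    have d: "d > 0" "d \<le> 1" "d * M < e"
    proof -
      have "d * M \<le> e / (2 * M) * M" unfolding d_def using M by (intro mult_right_mono) auto
      also have "\<dots> < e" using e M by simp
      finally show "d * M < e" .
    qed (use e M in \<open>auto simp: d_def\<close>)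
    have "\<exists>\<^sub>F k in sequentially. u k \<in> blinfun_apply \<phi> -` ball (blinfun_apply \<phi> l) d"
      using d(1) by (intro l openin_weak_vimage blinfun.bounded_linear_right) auto
    moreover have "\<forall>\<^sub>F k in sequentially. dist (r k) a < d"
      using r d(1) by (rule tendstoD)
    ultimately have "\<exists>\<^sub>F k in sequentially.
        dist (r k) a < d \<and> u k \<in> blinfun_apply \<phi> -` ball (blinfun_apply \<phi> l) d"
      by (rule frequently_eventually_conj)
    then show "\<exists>\<^sub>F k in sequentially. \<bar>blinfun_apply \<phi> (r k *\<^sub>R u k) - blinfun_apply \<phi> (a *\<^sub>R l)\<bar> < e"
    proof (rule frequently_elim1)
      fix k assume "dist (r k) a < d \<and> u k \<in> blinfun_apply \<phi> -` ball (blinfun_apply \<phi> l) d"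
      then have k: "\<bar>r k - a\<bar> \<le> d" "\<bar>blinfun_apply \<phi> (u k) - blinfun_apply \<phi> l\<bar> \<le> d"
        by (auto simp: dist_real_def)
      have "blinfun_apply \<phi> (r k *\<^sub>R u k) - blinfun_apply \<phi> (a *\<^sub>R l) =
          (r k - a) * blinfun_apply \<phi> (u k) + a * (blinfun_apply \<phi> (u k) - blinfun_apply \<phi> l)"
        by (simp add: blinfun.scaleR_right algebra_simps)
      also have "\<bar>\<dots>\<bar> \<le> \<bar>r k - a\<bar> * \<bar>blinfun_apply \<phi> (u k)\<bar> + \<bar>a\<bar> * \<bar>blinfun_apply \<phi> (u k) - blinfun_apply \<phi> l\<bar>"
        by (metis abs_mult abs_triangle_ineq)
      also have "\<dots> \<le> d * (\<bar>blinfun_apply \<phi> l\<bar> + 1) + \<bar>a\<bar> * d"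
        using k d by (intro add_mono mult_mono mult_left_mono) auto
      also have "\<dots> = d * M" by (simp add: M_def algebra_simps)
      finally show "\<bar>blinfun_apply \<phi> (r k *\<^sub>R u k) - blinfun_apply \<phi> (a *\<^sub>R l)\<bar> < e" using d(3) by simp
    qed
  qed
  then show thesis by (rule that)
qed

section \<open>Bump functions and subsequences\<close>

text \<open>A supremum of 1-Lipschitz cones, finite because their heights are at most
  \<open>\<epsilon>\<close>. Each cone vanishes at 0, since its centre has norm at least its height
  \<open>\<epsilon> * t n\<close>.\<close>

lemma lipschitz_bumps:
  fixes x :: "nat \<Rightarrow> 'a::real_normed_vector" and t :: "nat \<Rightarrow> real"
  assumes t: "\<And>n. 0 \<le> t n" "\<And>n. t n \<le> 1" and \<epsilon>: "0 \<le> \<epsilon>" and x: "\<And>n. \<epsilon> \<le> norm (x n)"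
  obtains f :: "'a \<Rightarrow> real" where "1-lipschitz_on UNIV f" "\<And>z. 0 \<le> f z" "f 0 = 0"
    "\<And>n. \<epsilon> * t n \<le> f (t n *\<^sub>R x n)"
    "\<And>z c. 0 \<le> c \<Longrightarrow> c < f z \<Longrightarrow> \<exists>n. c + norm (z - t n *\<^sub>R x n) < \<epsilon> * t n"
proof
  define g where "g n z = max 0 (\<epsilon> * t n - norm (z - t n *\<^sub>R x n))" for n z
  define f where "f z = (SUP n. g n z)" for z
  have "g n z \<le> \<epsilon>" for n z
  proof -
    have "\<epsilon> * t n - norm (z - t n *\<^sub>R x n) \<le> \<epsilon>"
      using mult_left_le[OF t(2)[of n] \<epsilon>] norm_ge_zero[of "z - t n *\<^sub>R x n"] by linarith
    then show ?thesis by (simp add: g_def \<epsilon>)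
  qed
  then have bdd: "bdd_above (range (\<lambda>n. g n z))" for z by (intro bdd_aboveI2)
  have le: "g n z \<le> f z" for n z
    unfolding f_def by (rule cSUP_upper[OF _ bdd]) simp
  show nonneg: "0 \<le> f z" for z
    using le[of 0 z] by (simp add: g_def)
  show "f 0 = 0"
  proof -
    have "g n 0 = 0" for n
      using mult_right_mono[OF x[of n] t(1)[of n]] by (simp add: g_def t(1) mult.commute)
    then show ?thesis by (simp add: f_def)
  qed
  show "\<epsilon> * t n \<le> f (t n *\<^sub>R x n)" for n
    using le[of n "t n *\<^sub>R x n"] by (simp add: g_def)
  show "\<exists>n. c + norm (z - t n *\<^sub>R x n) < \<epsilon> * t n" if c: "0 \<le> c" "c < f z" for z c
  proof -
    obtain n where "c < g n z"
      using c(2) less_cSUP_iff[OF _ bdd, of c z] by (auto simp: f_def)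
    then show ?thesis using c(1) by (intro exI[of _ n]) (auto simp: g_def less_max_iff_disj)
  qed
  have half: "f z \<le> f z' + dist z z'" for z z'
    unfolding f_def[of z]
  proof (rule cSUP_least)
    fix n
    have "norm (z' - t n *\<^sub>R x n) \<le> norm (z - t n *\<^sub>R x n) + dist z z'"
      using norm_triangle_ineq[of "z - t n *\<^sub>R x n" "z' - z"] by (simp add: dist_norm norm_minus_commute)
    then have "g n z \<le> g n z' + dist z z'" by (auto simp: g_def)
    then show "g n z \<le> f z' + dist z z'" using le[of n z'] by simp
  qed simp
  show "1-lipschitz_on UNIV f"
  proof (rule lipschitz_onI)
    show "dist (f z) (f z') \<le> 1 * dist z z'" for z z'
      using half[of z z'] half[of z' z] by (simp add: dist_real_def abs_le_iff dist_commute)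
  qed simp
qed

lemma subsequence_constant_or_at_top:
  fixes n :: "nat \<Rightarrow> nat"
  shows "(\<exists>(s :: nat \<Rightarrow> nat) m. strict_mono s \<and> (\<forall>k. n (s k) = m)) \<or> filterlim n at_top sequentially"
proof (cases "\<exists>m. infinite {k. n k = m}")
  case True
  then obtain m where "infinite {k. n k = m}" by blast
  then obtain s :: "nat \<Rightarrow> nat" where "strict_mono s" "\<And>k. n (s k) = m"
    using infinite_enumerate[of "{k. n k = m}"] by auto
  then show ?thesis by blast
next
  case False
  have "\<forall>\<^sub>F k in sequentially. N \<le> n k" for N
  proof -
    have "{k. \<not> N \<le> n k} = (\<Union>m\<in>{..<N}. {k. n k = m})" by auto
    then have "finite {k. \<not> N \<le> n k}" using False by simp
    then show ?thesis by (simp add: eventually_cofinite flip: cofinite_eq_sequentially)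
  qed
  then show ?thesis by (simp add: filterlim_at_top)
qed

section \<open>The two directions of the equivalence\<close>

text \<open>Testing on the image of the unit ball makes the difference quotients uniform over all
  directions of norm at most 1; the derivative is \<open>D \<circ> T\<close>.\<close>

lemma frechet_differentiable_comp_weakly_compact:
  fixes T :: "'b::real_normed_vector \<Rightarrow> 'a::real_normed_vector"
  assumes T: "weakly_compact_operator T" and f: "weak_hadamard_differentiable f (T y)"
  shows "frechet_differentiable (f \<circ> T) y"
proof -
  interpret T: bounded_linear T using T by (simp add: weakly_compact_operator_def)
  obtain D where D: "bounded_linear D" and
    L: "\<And>A. A \<noteq> {} \<Longrightarrow> relatively_weakly_compact A \<Longrightarrow>
      ((\<lambda>t. SUP u\<in>A. ereal \<bar>(f (T y + t *\<^sub>R u) - f (T y)) / t - D u\<bar>) \<longlongrightarrow> 0) (at 0)"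
    using f unfolding weak_hadamard_differentiable_def beta_differentiable_def by auto
  interpret D: bounded_linear D by (rule D)
  have ne: "T ` cball 0 1 \<noteq> {}" by simp
  have lim: "\<forall>e>0. \<forall>\<^sub>F t in at 0. \<forall>u\<in>T ` cball 0 1. \<bar>(f (T y + t *\<^sub>R u) - f (T y)) / t - D u\<bar> \<le> e"
    using L[OF ne] T unfolding weakly_compact_operator_def SUP_abs_tendsto_0_iff[OF ne] by blast
  have "((f \<circ> T) has_derivative D \<circ> T) (at y)"
    unfolding has_derivative_at_alt
  proof (intro conjI allI impI)
    show "bounded_linear (D \<circ> T)"
      using bounded_linear_compose[OF D T.bounded_linear_axioms] by (simp add: comp_def)
    fix e :: real assume e: "e > 0"
    then obtain d where d: "d > 0" and *: "\<And>t v. t \<noteq> 0 \<Longrightarrow> \<bar>t\<bar> < d \<Longrightarrow> norm v \<le> 1 \<Longrightarrow>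
        \<bar>(f (T y + t *\<^sub>R T v) - f (T y)) / t - D (T v)\<bar> \<le> e"
      using lim unfolding eventually_at by (auto simp: dist_real_def)
    have "norm ((f \<circ> T) z - (f \<circ> T) y - (D \<circ> T) (z - y)) \<le> e * norm (z - y)" if "norm (z - y) < d" for z
    proof (cases "z = y")
      case True
      then show ?thesis by (simp add: T.zero D.zero)
    next
      case False
      define t where "t = norm (z - y)"
      define v where "v = (z - y) /\<^sub>R t"
      have t: "t > 0" "t < d" using False that by (auto simp: t_def)
      have v: "norm v \<le> 1" "t *\<^sub>R v = z - y" using t by (auto simp: v_def t_def)
      have Tz: "T y + t *\<^sub>R T v = T z" using v(2) by (metis T.add T.scaleR add_diff_cancel_left' diff_add_cancel add.commute)
      have "\<bar>(f (T z) - f (T y)) / t - D (T v)\<bar> \<le> e" using *[of t v] t v(1) by (simp add: Tz)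
      moreover have "f (T z) - f (T y) - D (T (z - y)) = t * ((f (T z) - f (T y)) / t - D (T v))"
        using t by (simp add: v(2)[symmetric] T.scaleR D.scaleR field_simps)
      ultimately show ?thesis using t by (simp add: abs_mult t_def[symmetric] mult.commute)
    qed
    with d show "\<exists>d>0. \<forall>z. norm (z - y) < d \<longrightarrow>
        norm ((f \<circ> T) z - (f \<circ> T) y - (D \<circ> T) (z - y)) \<le> e * norm (z - y)" by blast
  qed
  then show ?thesis unfolding frechet_differentiable_iff_differentiable differentiable_def by blast
qed

lemma non_weakly_compact_operator_witness:
  fixes T :: "'b::real_normed_vector \<Rightarrow> 'a::banach"
  assumes T: "bounded_linear T" and nwc: "\<not> weakly_compact_operator T"
  obtains f :: "'a \<Rightarrow> real" where "1-lipschitz_on UNIV f" "weak_hadamard_differentiable f 0"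
    "\<not> frechet_differentiable (f \<circ> T) 0"
proof -
  interpret T: bounded_linear T by (rule T)
  obtain x :: "nat \<Rightarrow> 'a" and \<epsilon> where \<epsilon>: "\<epsilon> > 0" and x: "\<And>n. x n \<in> T ` cball 0 1" "\<And>n. \<epsilon> < norm (x n)"
    and cluster: "\<And>s w l. filterlim s at_top sequentially \<Longrightarrow> (\<And>k. norm (w k - x (s k)) \<le> \<epsilon>) \<Longrightarrow>
       \<not> scalar_cluster_point l w"
    using non_weakly_compact_sequence[OF bounded_linear_image[OF bounded_cball T], of 0 1] T nwc
    unfolding weakly_compact_operator_def by blast
  obtain y where y: "\<And>n. norm (y n) \<le> 1" "\<And>n. x n = T (y n)"
  proof -
    have "\<forall>n. \<exists>v. norm v \<le> 1 \<and> x n = T v" using x(1) unfolding image_iff by (metis mem_cball_0)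
    then show thesis using that by metis
  qed
  define t where "t n = inverse (real (Suc n))" for n
  have t: "t n > 0" "t n \<le> 1" for n by (auto simp: t_def inverse_le_1_iff)
  obtain f where f: "1-lipschitz_on UNIV f" "\<And>z. 0 \<le> f z" "f 0 = 0"
    "\<And>n. \<epsilon> * t n \<le> f (t n *\<^sub>R x n)"
    "\<And>z c. 0 \<le> c \<Longrightarrow> c < f z \<Longrightarrow> \<exists>n. c + norm (z - t n *\<^sub>R x n) < \<epsilon> * t n"
    using lipschitz_bumps[of t \<epsilon> x] t \<epsilon> x(2) by (metis less_imp_le)
  have small: "\<forall>\<^sub>F h in at 0. \<forall>u\<in>W. \<bar>f (h *\<^sub>R u) / h\<bar> \<le> e"
    if W: "relatively_weakly_compact W" and e: "e > 0" for W e
  proof (rule ccontr)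
    assume contra: "\<not> ?thesis"
    \<comment> \<open>A quotient above \<open>e\<close> places \<open>h *\<^sub>R u\<close> inside
      some bump, at a point where that bump exceeds \<open>e * \<bar>h\<bar>\<close>.\<close>
    have "\<exists>h u n. \<bar>h\<bar> < inverse (real (Suc k)) \<and> u \<in> W \<and>
        e * \<bar>h\<bar> + norm (h *\<^sub>R u - t n *\<^sub>R x n) < \<epsilon> * t n" for k
    proof -
      have "inverse (real (Suc k)) > 0" by simp
      then have "\<not> (\<forall>h\<in>UNIV. h \<noteq> 0 \<and> dist h 0 < inverse (real (Suc k)) \<longrightarrow>
          (\<forall>u\<in>W. \<bar>f (h *\<^sub>R u) / h\<bar> \<le> e))"
        using contra unfolding eventually_at by blast
      then obtain h u where h: "h \<noteq> 0" "\<bar>h\<bar> < inverse (real (Suc k))" "u \<in> W" "e < \<bar>f (h *\<^sub>R u) / h\<bar>"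
        unfolding not_le[symmetric] dist_real_def by auto
      then have "e * \<bar>h\<bar> < f (h *\<^sub>R u)"
        using f(2)[of "h *\<^sub>R u"] by (simp add: abs_divide field_simps)
      then show ?thesis using f(5)[of "e * \<bar>h\<bar>" "h *\<^sub>R u"] h e by auto
    qed
    then obtain h u n where h: "\<And>k. \<bar>h k\<bar> < inverse (real (Suc k))" and u: "\<And>k. u k \<in> W"
      and hu: "\<And>k. e * \<bar>h k\<bar> + norm (h k *\<^sub>R u k - t (n k) *\<^sub>R x (n k)) < \<epsilon> * t (n k)"
      by metis
    \<comment> \<open>Rescaling the bump to height \<open>\<epsilon>\<close> around
      \<open>x (n k)\<close> keeps the multiples \<open>r k *\<^sub>R u k\<close> within
      \<open>\<epsilon>\<close> of it; the summand with \<open>e\<close> bounds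
      \<open>r\<close>.\<close>
    define r where "r k = h k / t (n k)" for k
    have ru: "e * \<bar>r k\<bar> + norm (r k *\<^sub>R u k - x (n k)) < \<epsilon>" for k
    proof -
      have hr: "h k = t (n k) * r k" using t(1)[of "n k"] by (simp add: r_def)
      have "h k *\<^sub>R u k - t (n k) *\<^sub>R x (n k) = t (n k) *\<^sub>R (r k *\<^sub>R u k - x (n k))"
        by (simp add: hr scaleR_diff_right)
      then have "norm (h k *\<^sub>R u k - t (n k) *\<^sub>R x (n k)) = t (n k) * norm (r k *\<^sub>R u k - x (n k))"
        using t(1)[of "n k"] by simp
      moreover have "\<bar>h k\<bar> = t (n k) * \<bar>r k\<bar>" using t(1)[of "n k"] by (simp add: hr abs_mult)
      ultimately have "t (n k) * (e * \<bar>r k\<bar> + norm (r k *\<^sub>R u k - x (n k))) < t (n k) * \<epsilon>"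
        using hu[of k] by (simp add: algebra_simps)
      then show ?thesis using t(1)[of "n k"] by simp
    qed
    have near: "norm (r k *\<^sub>R u k - x (n k)) \<le> \<epsilon>" for k
    proof -
      have "0 \<le> e * \<bar>r k\<bar>" using e by simp
      then show ?thesis using ru[of k] by linarith
    qed
    consider (const) s :: "nat \<Rightarrow> nat" and m where "strict_mono s" "\<And>k. n (s k) = m" | (lim) "filterlim n at_top sequentially"
      using subsequence_constant_or_at_top[of n] by blast
    then show False
    proof cases
      case const
      \<comment> \<open>For a constant index the factors \<open>r (s k)\<close> tend to 0, so 0 is a
        scalar cluster point of a sequence within \<open>\<epsilon>\<close> of \<open>x m\<close>.
        The functional norming \<open>x m\<close> excludes this, as
        \<open>\<epsilon> < norm (x m)\<close>.\<close>
      have "h \<longlonglongrightarrow> 0"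
        by (rule Lim_null_comparison[OF _ LIMSEQ_inverse_real_of_nat]) (use h in \<open>auto intro!: always_eventually less_imp_le\<close>)
      then have "(\<lambda>k. h (s k)) \<longlonglongrightarrow> 0"
        using LIMSEQ_subseq_LIMSEQ[OF _ const(1)] by (simp add: comp_def)
      then have "(\<lambda>k. r (s k)) \<longlonglongrightarrow> 0"
        by (simp add: r_def const(2) tendsto_divide_zero)
      then obtain l where l: "scalar_cluster_point (0 *\<^sub>R l) (\<lambda>k. r (s k) *\<^sub>R u (s k))"
        using relatively_weakly_compact_scalar_cluster_point[OF W u, of "\<lambda>k. r (s k)" 0 s] by blast
      obtain \<phi> :: "'a \<Rightarrow>\<^sub>L real" where \<phi>: "norm \<phi> \<le> 1" "blinfun_apply \<phi> (x m) = norm (x m)"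
        by (rule norming_functional)
      have "\<exists>\<^sub>F k in sequentially.
          \<bar>blinfun_apply \<phi> (r (s k) *\<^sub>R u (s k)) - blinfun_apply \<phi> (0 *\<^sub>R l)\<bar> < norm (x m) - \<epsilon>"
        using l x(2)[of m] unfolding scalar_cluster_point_def by simp
      then obtain k where k: "\<bar>blinfun_apply \<phi> (r (s k) *\<^sub>R u (s k))\<bar> < norm (x m) - \<epsilon>"
        by (auto dest: frequently_ex)
      have "\<bar>blinfun_apply \<phi> (r (s k) *\<^sub>R u (s k) - x m)\<bar> \<le> norm (r (s k) *\<^sub>R u (s k) - x m)"
        by (rule abs_blinfun_apply_le_norm[OF \<phi>(1)])
      then show False
        using k near[of "s k"] \<phi>(2) by (simp add: const(2) blinfun.diff_right)
    next
      case lim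
      have "\<bar>r k\<bar> \<le> \<epsilon> / e" for k
      proof -
        have "e * \<bar>r k\<bar> \<le> \<epsilon>"
          using ru[of k] norm_ge_zero[of "r k *\<^sub>R u k - x (n k)"] by linarith
        then show ?thesis using e by (simp add: pos_le_divide_eq mult.commute)
      qed
      then have "r k \<in> {- (\<epsilon> / e)..\<epsilon> / e}" for k by (simp add: abs_le_iff minus_le_iff)
      then obtain a and s :: "nat \<Rightarrow> nat" where s: "strict_mono s" "(r \<circ> s) \<longlonglongrightarrow> a"
        using seq_compactE[OF compact_imp_seq_compact[OF compact_Icc]] by metis
      obtain l where "scalar_cluster_point (a *\<^sub>R l) (\<lambda>k. (r \<circ> s) k *\<^sub>R u (s k))"
        using relatively_weakly_compact_scalar_cluster_point[OF W u s(2), of s] by blast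
      moreover have "filterlim (\<lambda>k. n (s k)) at_top sequentially"
        using filterlim_compose[OF lim filterlim_subseq[OF s(1)]] .
      ultimately show False
        using cluster[of "\<lambda>k. n (s k)" "\<lambda>k. (r \<circ> s) k *\<^sub>R u (s k)"] near by simp
    qed
  qed
  have "weak_hadamard_differentiable f 0"
    unfolding weak_hadamard_differentiable_def beta_differentiable_def
  proof (intro exI[of _ "\<lambda>_. 0"] conjI ballI bounded_linear_zero)
    fix A :: "'a set" assume "A \<in> {A. A \<noteq> {} \<and> relatively_weakly_compact A}"
    then have A: "A \<noteq> {}" "relatively_weakly_compact A" by auto
    show "((\<lambda>t. SUP u\<in>A. ereal \<bar>(f (0 + t *\<^sub>R u) - f 0) / t - 0\<bar>) \<longlongrightarrow> 0) (at 0)"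
      unfolding SUP_abs_tendsto_0_iff[OF A(1)] using small[OF A(2)] by (simp add: f(3))
  qed
  moreover have "\<not> frechet_differentiable (f \<circ> T) 0"
  proof
    assume "frechet_differentiable (f \<circ> T) 0"
    then obtain D where
      L: "\<And>A. A \<noteq> {} \<Longrightarrow> bounded A \<Longrightarrow>
        ((\<lambda>h. SUP u\<in>A. ereal \<bar>((f \<circ> T) (0 + h *\<^sub>R u) - (f \<circ> T) 0) / h - D u\<bar>) \<longlongrightarrow> 0) (at 0)"
      unfolding frechet_differentiable_def beta_differentiable_def by auto
    have ne: "cball 0 1 \<noteq> ({} :: 'b set)" by simp
    \<comment> \<open>In direction \<open>y n\<close> the quotient is at least
      \<open>\<epsilon>\<close> at \<open>t n\<close> and at most 0 at \<open>- t n\<close>; both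
      cannot be within \<open>\<epsilon> / 3\<close> of the same \<open>D (y n)\<close>.\<close>
    have "\<forall>\<^sub>F h in at 0. \<forall>u\<in>cball 0 1. \<bar>((f \<circ> T) (0 + h *\<^sub>R u) - (f \<circ> T) 0) / h - D u\<bar> \<le> \<epsilon> / 3"
      using L[OF ne bounded_cball] \<epsilon> unfolding SUP_abs_tendsto_0_iff[OF ne] by (meson divide_pos_pos zero_less_numeral)
    then obtain d where d: "d > 0" and *: "\<And>h u. h \<noteq> 0 \<Longrightarrow> \<bar>h\<bar> < d \<Longrightarrow> norm u \<le> 1 \<Longrightarrow>
        \<bar>f (h *\<^sub>R T u) / h - D u\<bar> \<le> \<epsilon> / 3"
      unfolding eventually_at by (auto simp: dist_real_def T.scaleR T.zero f(3))
    obtain n where n: "t n < d" using reals_Archimedean[OF d] by (auto simp: t_def)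
    have "\<epsilon> \<le> f (t n *\<^sub>R x n) / t n" using f(4)[of n] t(1)[of n] by (simp add: field_simps)
    moreover have "\<bar>f (t n *\<^sub>R x n) / t n - D (y n)\<bar> \<le> \<epsilon> / 3"
      using *[of "t n" "y n"] t(1)[of n] n y by auto
    moreover have "f ((- t n) *\<^sub>R x n) / (- t n) \<le> 0"
      using f(2)[of "(- t n) *\<^sub>R x n"] t(1)[of n] by (simp add: divide_nonneg_pos)
    moreover have "\<bar>f ((- t n) *\<^sub>R x n) / (- t n) - D (y n)\<bar> \<le> \<epsilon> / 3"
      using *[of "- t n" "y n"] t(1)[of n] n y by auto
    ultimately show False using \<epsilon> by linarith
  qed
  ultimately show thesis using f(1) that by blast
qed

theorem theorem1p3:
  fixes T :: "'b::banach \<Rightarrow> 'a::banach"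
  assumes "bounded_linear T"
  shows "weakly_compact_operator T \<longleftrightarrow>
    (\<forall>f :: 'a \<Rightarrow> real. (\<exists>L. L-lipschitz_on UNIV f) \<longrightarrow>
      (\<forall>y. weak_hadamard_differentiable f (T y) \<longrightarrow> frechet_differentiable (f \<circ> T) y))"
proof
  assume "weakly_compact_operator T"
  then show "\<forall>f :: 'a \<Rightarrow> real. (\<exists>L. L-lipschitz_on UNIV f) \<longrightarrow>
      (\<forall>y. weak_hadamard_differentiable f (T y) \<longrightarrow> frechet_differentiable (f \<circ> T) y)"
    by (blast intro: frechet_differentiable_comp_weakly_compact)
next
  assume R: "\<forall>f :: 'a \<Rightarrow> real. (\<exists>L. L-lipschitz_on UNIV f) \<longrightarrow>
      (\<forall>y. weak_hadamard_differentiable f (T y) \<longrightarrow> frechet_differentiable (f \<circ> T) y)"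
  \<comment> \<open>The witness is built at the origin, so the hypothesis is applied at
    \<open>y = 0\<close>.\<close>
  have T0: "T 0 = 0" using assms by (rule linear_simps)
  show "weakly_compact_operator T"
  proof (rule ccontr)
    assume "\<not> weakly_compact_operator T"
    then obtain f :: "'a \<Rightarrow> real" where "1-lipschitz_on UNIV f"
      "weak_hadamard_differentiable f (T 0)" "\<not> frechet_differentiable (f \<circ> T) 0"
      using non_weakly_compact_operator_witness[OF assms] unfolding T0 by blast
    with R show False by blast
  qed
qed

end
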